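(* Fix an integer $c\geq 2$, a positive integer $n$, and positive integers $e_1,\dots,e_n$. Let $u=I_{c}^{e_{1}}D_{c}^{e_{2}}I_{c}^{e_{3}}\ldots \mathcal{L}_{c}^{e_{n}}$, where $\mathcal{L}$ is $I$ if $n$ is odd and $D$ if $n$ is even. Define $A= \sum_{i\geq 1}e_{2i-1}$ and $B = \sum_{i\geq 1}e_{2i}$, $M= \max(A, B)$ and $m= \min(A, B)$. Then $$(c-1)m+M+ \lfloor n/2\rfloor\leq \mathit{fw}(u)\leq 2(c-1)m+2M+2\lfloor n/2\rfloor-1.$$
   Context: Sequences are finite words over an alphabet of letters. A sequence $s$ contains a sequence $u$ if some subsequence (not necessarily contiguous) of $s$ can be changed into $u$ by a one-to-one renaming of its letters; otherwise $s$ avoids $u$. An $(r,s)$-formation is a concatenation of $s$ permutations of the same set of $r$ distinct letters. The formation width $\mathit{fw}(u)$ of a sequence $u$ is the minimum $s$ such that there exists $r$ for which every $(r,s)$-formation contains $u$. $I_c$ denotes the sequence $1\,2\ldots c$ and $D_c$ the sequence $c\,(c-1)\ldots 1$; powers denote repeated concatenation. *)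

theory Defs
  imports Main "HOL-Library.Sublist"
begin

definition contains :: "'a list \<Rightarrow> 'b list \<Rightarrow> bool" where
  "contains s u \<longleftrightarrow> (\<exists>t g. subseq t s \<and> inj_on g (set t) \<and> map g t = u)"

definition formation :: "nat \<Rightarrow> nat \<Rightarrow> 'a list \<Rightarrow> bool" where
  "formation r s f \<longleftrightarrow>
     (\<exists>X ps. finite X \<and> card X = r \<and> length ps = s \<and>
        (\<forall>p\<in>set ps. distinct p \<and> set p = X) \<and> f = concat ps)"

text \<open>Formations are taken over the infinite alphabet \<open>nat\<close>; this loses nothing, since
  containment is invariant under injective renaming of letters.\<close>

definition fw :: "'a list \<Rightarrow> nat" where
  "fw u = (LEAST s. \<exists>r. \<forall>f :: nat list. formation r s f \<longrightarrow> contains f u)"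

definition inc_word :: "nat \<Rightarrow> nat list" where
  "inc_word c = [1..<Suc c]"

definition dec_word :: "nat \<Rightarrow> nat list" where
  "dec_word c = rev [1..<Suc c]"

definition word_power :: "'a list \<Rightarrow> nat \<Rightarrow> 'a list" where
  "word_power w k = concat (replicate k w)"

definition alternating_word :: "nat \<Rightarrow> nat \<Rightarrow> (nat \<Rightarrow> nat) \<Rightarrow> nat list" where
  "alternating_word c n e =
     concat (map (\<lambda>i. word_power (if odd i then inc_word c else dec_word c) (e i)) [1..<Suc n])"

end

(*
  Let L = (c - 1) m + M + n div 2. The word u embeds, after renaming its letters, into the power b^L
  of a word b of c distinct letters: I_c and D_c cost 1 and c - 1 copies of b each, or c - 1 and 1,
  plus one extra copy per D-run.

  Upper bound: by iterated Ramsey, in a long enough formation of 2L - 1 permutations some c letters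
  occur in one fixed order b or in its reverse in every permutation, so one of b^L and (rev b)^L is
  a subsequence.

  Lower bound: for every r, the s-fold repetition of a single permutation 1..r contains no word with
  s or more non-ascents, and any renaming of u has at least L - 1 of them, because a cyclic word of
  c \<ge> 2 distinct letters has between 1 and c - 1 cyclic non-ascents, and reversal exchanges ascents
  and non-ascents.
*)
theory Submission
  imports Defs "HOL-Library.Ramsey"
begin

section \<open>Monotone subsequences common to several permutations\<close>

lemma subseq_distinct: "subseq xs ys \<Longrightarrow> distinct ys \<Longrightarrow> distinct xs"
  by (auto simp: subseq_conv_nths)

lemma set_mono_subseq: "subseq xs ys \<Longrightarrow> set xs \<subseteq> set ys"
  by (auto simp: subseq_conv_nths dest: in_set_nthsD)

lemma subseq_rev: "subseq xs ys \<Longrightarrow> subseq (rev xs) (rev ys)"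
  by (induction rule: list_emb.induct) (auto intro: list_emb_append_mono)

lemma sorted_wrt_subseqI:
  assumes "\<And>x y. subseq [x, y] b \<Longrightarrow> P x y"
  shows "sorted_wrt P b"
  using assms
proof (induction b)
  case (Cons x b)
  have "P x y" if "y \<in> set b" for y
    using that Cons.prems by (auto simp: subseq_singleton_left)
  moreover have "sorted_wrt P b"
    by (rule Cons.IH) (auto intro: Cons.prems)
  ultimately show ?case by simp
qed simp

text \<open>\<open>subseq [x, y] p\<close> encodes that x comes before y in p. This lemma and the
  next supply asymmetry and totality.\<close>

lemma distinct_subseq_antisym:
  assumes "distinct p" "subseq [x, y] p" "subseq [y, x] p"
  shows False
  using assms
proof (induction p)
  case (Cons z p)
  have "x \<noteq> y"
    using Cons.prems(1,2) by (metis distinct_length_2_or_more subseq_distinct)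
  with Cons show ?case
    by (auto simp: subseq_singleton_left split: if_splits dest: subseq_Cons2_neq set_mono_subseq)
qed simp

lemma subseq_pair_cases:
  assumes "x \<in> set p" "y \<in> set p" "x \<noteq> y"
  shows "subseq [x, y] p \<or> subseq [y, x] p"
  using assms by (induction p) (auto simp: subseq_singleton_left)

text \<open>Induction on p: its first letter z precedes all others, so z can occur in b only as the
  head. It is matched there or skipped.\<close>

lemma subseq_if_pairwise:
  assumes "distinct b" "set b \<subseteq> set p" "distinct p" "sorted_wrt (\<lambda>x y. subseq [x, y] p) b"
  shows "subseq b p"
  using assms
proof (induction p arbitrary: b)
  case (Cons z p)
  show ?case
  proof (cases b)
    case (Cons x b')
    have *: "subseq [y, w] p" if "subseq [y, w] (z # p)" "y \<noteq> z" for y w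
      using that by (auto split: if_splits)
    show ?thesis
    proof (cases "x = z")
      case True
      have z: "z \<notin> set b'" using Cons.prems Cons True by auto
      have "sorted_wrt (\<lambda>x y. subseq [x, y] p) b'"
        using Cons.prems(4) Cons z
        by (auto intro!: * elim!: sorted_wrt_mono_rel[rotated])
      moreover have "set b' \<subseteq> set p" using Cons.prems Cons True z by auto
      ultimately have "subseq b' p" using Cons.IH Cons.prems Cons by auto
      then show ?thesis using Cons True by simp
    next
      case False
      have z: "z \<notin> set b'"
      proof
        assume "z \<in> set b'"
        then have "subseq [x, z] p" using Cons.prems(4) Cons False by auto
        then have "z \<in> set p" by (auto dest: set_mono_subseq)
        then show False using Cons.prems(3) by simp
      qed
      have "sorted_wrt (\<lambda>x y. subseq [x, y] p) b"
        using Cons.prems(4) Cons z False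
        by (auto intro!: * elim!: sorted_wrt_mono_rel[rotated])
      moreover have "set b \<subseteq> set p" using Cons.prems Cons False z by auto
      ultimately have "subseq b p" using Cons.IH Cons.prems by auto
      then show ?thesis by auto
    qed
  qed simp
qed simp

text \<open>Two-colour Ramsey on the letters of a: colour a pair by whether a and p order it alike.
  A clique gives a common order, an independent set opposite orders.\<close>

lemma monotone_subseq:
  "\<exists>N. \<forall>a p :: 'a list. distinct a \<and> distinct p \<and> set a \<subseteq> set p \<and> N \<le> length a \<longrightarrow>
     (\<exists>b. subseq b a \<and> length b = c \<and> (subseq b p \<or> subseq (rev b) p))"
proof -
  obtain N where N: "\<And>(V::'a set) E. finite V \<Longrightarrow> N \<le> card V \<Longrightarrow>
      \<exists>R\<subseteq>V. card R = c \<and> clique R E \<or> card R = c \<and> indep R E"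
    using ramsey2[of c c] by blast
  have "\<exists>b. subseq b a \<and> length b = c \<and> (subseq b p \<or> subseq (rev b) p)"
    if a: "distinct a" and p: "distinct p" and ap: "set a \<subseteq> set p" and "N \<le> length a"
    for a p :: "'a list"
  proof -
    define E where "E = {{x, y} | x y. subseq [x, y] a \<and> subseq [x, y] p}"
    obtain R where R: "R \<subseteq> set a" "card R = c" "clique R E \<or> indep R E"
      using N[of "set a" E] \<open>N \<le> length a\<close> distinct_card[OF a] by (metis List.finite_set)
    define b where "b = filter (\<lambda>x. x \<in> R) a"
    have b: "subseq b a" "distinct b" "set b = R" using a R by (auto simp: b_def)
    have len: "length b = c" using b R distinct_card by metis
    have bp: "set b \<subseteq> set p" using b R ap by auto
    have elems: "x \<in> R \<and> y \<in> R \<and> x \<noteq> y \<and> subseq [x, y] a" if "subseq [x, y] b" for x y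
      using that b by (metis distinct_length_2_or_more list.set_intros set_mono_subseq subseq_distinct
          subseq_order.trans subsetD)
    from R(3) show ?thesis
    proof
      assume "clique R E"
      have "sorted_wrt (\<lambda>x y. subseq [x, y] p) b"
      proof (rule sorted_wrt_subseqI)
        fix x y assume xy: "subseq [x, y] b"
        then have "{x, y} \<in> E" using elems \<open>clique R E\<close> by (auto simp: clique_def)
        \<comment> \<open>Membership in \<open>E\<close> could also stem from the pair read as y, x;
          the order of x and y in a excludes this.\<close>
        then show "subseq [x, y] p"
          using elems[OF xy] distinct_subseq_antisym[OF a] by (auto simp: E_def doubleton_eq_iff)
      qed
      then show ?thesis using subseq_if_pairwise b bp p len by blast
    next
      assume "indep R E"
      have "sorted_wrt (\<lambda>x y. subseq [y, x] p) b"
      proof (rule sorted_wrt_subseqI)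
        fix x y assume xy: "subseq [x, y] b"
        then have "{x, y} \<notin> E" using elems \<open>indep R E\<close> by (auto simp: indep_def)
        then have "\<not> subseq [x, y] p" using elems[OF xy] by (auto simp: E_def)
        then show "subseq [y, x] p"
          using subseq_pair_cases[of x p y] elems[OF xy] bp b by auto
      qed
      then have "subseq (rev b) p"
        by (intro subseq_if_pairwise) (use b bp p in \<open>auto simp: sorted_wrt_rev\<close>)
      then show ?thesis using b len by blast
    qed
  qed
  then show ?thesis by blast
qed

text \<open>One permutation is treated at a time. The others must first leave K letters, the bound
  that \<open>monotone_subseq\<close> needs to keep c of them; hence c is arbitrary in the
  induction.\<close>

lemma common_monotone_subseq:
  "\<exists>N. \<forall>(a :: 'a list) ps. distinct a \<and> length ps = s \<and> (\<forall>p\<in>set ps. distinct p \<and> set a \<subseteq> set p)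
     \<and> N \<le> length a \<longrightarrow>
     (\<exists>b. subseq b a \<and> length b = c \<and> (\<forall>p\<in>set ps. subseq b p \<or> subseq (rev b) p))"
proof (induction s arbitrary: c)
  case 0
  have "\<exists>b. subseq b a \<and> length b = c" if "c \<le> length a" for a :: "'a list"
    using that by (intro exI[of _ "take c a"]) (auto simp: take_is_prefix)
  then show ?case by (intro exI[of _ c]) auto
next
  case (Suc s)
  obtain K where K: "\<And>a p :: 'a list. distinct a \<Longrightarrow> distinct p \<Longrightarrow> set a \<subseteq> set p \<Longrightarrow> K \<le> length a \<Longrightarrow>
     (\<exists>b. subseq b a \<and> length b = c \<and> (subseq b p \<or> subseq (rev b) p))"
    using monotone_subseq[of c] by blast
  obtain N where N: "\<And>(a :: 'a list) ps. distinct a \<Longrightarrow> length ps = s \<Longrightarrow>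
     (\<forall>p\<in>set ps. distinct p \<and> set a \<subseteq> set p) \<Longrightarrow> N \<le> length a \<Longrightarrow>
     (\<exists>b. subseq b a \<and> length b = K \<and> (\<forall>p\<in>set ps. subseq b p \<or> subseq (rev b) p))"
    using Suc.IH[of K] by blast
  have "\<exists>b. subseq b a \<and> length b = c \<and> (\<forall>p\<in>set ps. subseq b p \<or> subseq (rev b) p)"
    if a: "distinct a" and len: "length ps = Suc s" "N \<le> length a"
      and ps: "\<forall>p\<in>set ps. distinct p \<and> set a \<subseteq> set p" for a :: "'a list" and ps
  proof -
    obtain q qs where qs: "ps = q # qs" "length qs = s"
      using len(1) by (auto simp: length_Suc_conv)
    obtain b where b: "subseq b a" "length b = K" "\<forall>p\<in>set qs. subseq b p \<or> subseq (rev b) p"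
      using N[of a qs] a len ps qs by auto
    have "distinct b" "set b \<subseteq> set q"
      using b a ps qs by (auto intro: subseq_distinct dest: set_mono_subseq)
    then obtain d where d: "subseq d b" "length d = c" "subseq d q \<or> subseq (rev d) q"
      using K[of b q] b ps qs by auto
    \<comment> \<open>Passing from b to d keeps the condition on \<open>qs\<close>: where
      \<open>rev b\<close> embeds, so does \<open>rev d\<close>.\<close>
    have "subseq (rev d) (rev b)" using d(1) by (rule subseq_rev)
    then have "\<forall>p\<in>set qs. subseq d p \<or> subseq (rev d) p"
      using b(3) d(1) subseq_order.trans by metis
    then show ?thesis using d b qs subseq_order.trans by (intro exI[of _ d]) auto
  qed
  then show ?case by blast
qed

section \<open>Powers of a word\<close>

lemma word_power_0 [simp]: "word_power w 0 = []"
  by (simp add: word_power_def)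

lemma word_power_Suc [simp]: "word_power w (Suc k) = w @ word_power w k"
  by (simp add: word_power_def)

lemma word_power_add: "word_power w (j + k) = word_power w j @ word_power w k"
  by (induction j) auto

lemma set_word_power: "set (word_power w k) = (if k = 0 then {} else set w)"
  by (auto simp: word_power_def)

lemma map_word_power: "map g (word_power w k) = word_power (map g w) k"
  by (induction k) auto

lemma word_power_mult: "word_power (word_power w j) k = word_power w (j * k)"
  by (induction k) (auto simp: word_power_add)

lemma word_power_eq_Nil_iff: "word_power w k = [] \<longleftrightarrow> k = 0 \<or> w = []"
  by (induction k) auto

lemma hd_word_power: "k > 0 \<Longrightarrow> hd (word_power w k) = hd w"
  by (cases "w = []", simp add: word_power_def, cases k) auto

lemma last_word_power: "k > 0 \<Longrightarrow> last (word_power w k) = last w"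
  by (cases "w = []", simp add: word_power_def, induction k) (auto simp: last_append word_power_def)

lemma subseq_word_power_mono: "subseq v w \<Longrightarrow> subseq (word_power v k) (word_power w k)"
  by (induction k) (auto intro: list_emb_append_mono)

lemma subseq_word_power_length:
  assumes "set v \<subseteq> set w"
  shows "subseq v (word_power w (length v))"
  using assms
proof (induction v)
  case (Cons x v)
  then have "subseq ([x] @ v) (w @ word_power w (length v))"
    by (intro list_emb_append_mono) (auto simp: subseq_singleton_left)
  then show ?case by simp
qed simp

lemma subseq_concat_word_power:
  assumes "length (filter (subseq b) ps) \<ge> k"
  shows "subseq (word_power b k) (concat ps)"
  using assms
proof (induction ps arbitrary: k)
  case (Cons p ps)
  show ?case
  proof (cases "subseq b p \<and> k > 0")
    case True
    then obtain j where "k = Suc j" by (cases k) auto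
    with Cons True have "subseq (b @ word_power b j) (p @ concat ps)"
      by (intro list_emb_append_mono) auto
    then show ?thesis using \<open>k = Suc j\<close> by simp
  next
    case False
    then have "subseq (word_power b k) (concat ps)"
      using Cons by (cases "k = 0") auto
    then show ?thesis by (auto intro: subseq_drop_many)
  qed
qed simp

text \<open>Later only distinctness and length of the base word matter, so the more frequent of b
  and \<open>rev b\<close> may be taken.\<close>

lemma formation_contains_word_power:
  "\<exists>r. \<forall>f :: 'a list. formation r (2 * L - 1) f \<longrightarrow>
     (\<exists>b. distinct b \<and> length b = c \<and> subseq (word_power b L) f)"
proof -
  obtain N where N: "\<And>(a :: 'a list) ps. distinct a \<Longrightarrow> length ps = 2 * L - 1 \<Longrightarrow>
     (\<forall>p\<in>set ps. distinct p \<and> set a \<subseteq> set p) \<Longrightarrow> N \<le> length a \<Longrightarrow>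
     (\<exists>b. subseq b a \<and> length b = c \<and> (\<forall>p\<in>set ps. subseq b p \<or> subseq (rev b) p))"
    using common_monotone_subseq[of "2 * L - 1" c] by blast
  have "\<exists>b. distinct b \<and> length b = c \<and> subseq (word_power b L) f"
    if f: "formation N (2 * L - 1) f" for f :: "'a list"
  proof -
    obtain X ps where X: "finite X" "card X = N" and ps: "length ps = 2 * L - 1"
      "\<forall>p\<in>set ps. distinct p \<and> set p = X" "f = concat ps"
      using f unfolding formation_def by blast
    obtain a where a: "distinct a" "set a = X"
      using finite_distinct_list X by blast
    have "\<forall>p\<in>set ps. distinct p \<and> set a \<subseteq> set p" "N \<le> length a"
      using ps(2) a X(2) distinct_card[OF a(1)] by auto
    then obtain b where b: "subseq b a" "length b = c"
      "\<forall>p\<in>set ps. subseq b p \<or> subseq (rev b) p"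
      using N a(1) ps(1) by blast
    have "distinct b" using a b subseq_distinct by blast
    \<comment> \<open>Pigeonhole: of 2L - 1 permutations, at least L contain b or at least L contain
      \<open>rev b\<close>.\<close>
    have "length ps = length (filter (subseq b) ps) + length (filter (\<lambda>p. \<not> subseq b p) ps)"
      by (simp add: sum_length_filter_compl)
    also have "length (filter (\<lambda>p. \<not> subseq b p) ps) \<le> length (filter (subseq (rev b)) ps)"
      using b(3) by (induction ps) auto
    finally have "L \<le> length (filter (subseq b) ps) \<or> L \<le> length (filter (subseq (rev b)) ps)"
      using ps by linarith
    then have "subseq (word_power b L) f \<or> subseq (word_power (rev b) L) f"
      using subseq_concat_word_power ps(3) by blast
    then show ?thesis using \<open>distinct b\<close> b(2) by (metis distinct_rev length_rev)
  qed
  then show ?thesis by blast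
qed


section \<open>Alternating words\<close>

text \<open>The base word is a parameter, so that renaming the letters only changes p.\<close>

definition alternating :: "'a list \<Rightarrow> nat \<Rightarrow> (nat \<Rightarrow> nat) \<Rightarrow> 'a list" where
  "alternating p n e =
     concat (map (\<lambda>i. word_power (if odd i then p else rev p) (e i)) [1..<Suc n])"

lemma alternating_word_eq: "alternating_word c n e = alternating (inc_word c) n e"
  unfolding alternating_word_def alternating_def dec_word_def inc_word_def ..

lemma alternating_0 [simp]: "alternating p 0 e = []"
  by (simp add: alternating_def)

lemma alternating_Suc:
  "alternating p (Suc n) e =
     alternating p n e @ word_power (if odd (Suc n) then p else rev p) (e (Suc n))"
  by (simp add: alternating_def)

lemma map_alternating: "map g (alternating p n e) = alternating (map g p) n e"
  by (induction n) (auto simp: alternating_Suc map_word_power rev_map)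

lemma set_alternating_subset: "set (alternating p n e) \<subseteq> set p"
  by (induction n) (auto simp: alternating_Suc set_word_power)

lemma set_alternating_superset: "n \<ge> 1 \<Longrightarrow> e 1 \<ge> 1 \<Longrightarrow> set p \<subseteq> set (alternating p n e)"
  by (induction n rule: nat_induct_at_least) (auto simp: alternating_Suc set_word_power)

lemma sum_upto_filter_Suc:
  "(\<Sum>i | 1 \<le> i \<and> i \<le> Suc n \<and> P i. e i :: nat) =
     (\<Sum>i | 1 \<le> i \<and> i \<le> n \<and> P i. e i) + (if P (Suc n) then e (Suc n) else 0)"
proof -
  have "{i. 1 \<le> i \<and> i \<le> Suc n \<and> P i} =
      (if P (Suc n) then insert (Suc n) {i. 1 \<le> i \<and> i \<le> n \<and> P i} else {i. 1 \<le> i \<and> i \<le> n \<and> P i})"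
    by (auto simp: le_Suc_eq)
  then show ?thesis by (auto simp: add.commute)
qed

section \<open>Embedding an alternating word into a power\<close>

text \<open>Here j and k are prices per repetition, and n div 2 is the number of runs of
  \<open>rev p\<close>, each paying one extra copy.\<close>

lemma subseq_alternating_word_power:
  assumes p: "\<And>d. subseq (word_power p d) (word_power b (j * d))"
    and q: "\<And>d. subseq (word_power (rev p) d) (word_power b (k * d + 1))"
  shows "subseq (alternating p n e) (word_power b
     (j * (\<Sum>i | 1 \<le> i \<and> i \<le> n \<and> odd i. e i) + k * (\<Sum>i | 1 \<le> i \<and> i \<le> n \<and> even i. e i) + n div 2))"
    (is "subseq _ (word_power b (?N n))")
proof (induction n)
  case (Suc n)
  define d where "d = (if odd (Suc n) then j * e (Suc n) else k * e (Suc n) + 1)"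
  have "?N (Suc n) = ?N n + d"
    unfolding sum_upto_filter_Suc d_def by (auto simp: algebra_simps)
  moreover have "subseq (word_power (if odd (Suc n) then p else rev p) (e (Suc n))) (word_power b d)"
    using p q by (simp add: d_def)
  ultimately show ?case
    using Suc.IH by (simp only: alternating_Suc word_power_add list_emb_append_mono)
qed simp

text \<open>This reversal starts at the same letter as the host. One copy of the host supplies x and
  the last letter of xs; every other letter takes one copy, \<open>length xs\<close> in
  total.\<close>

lemma subseq_power_rotated_rev:
  assumes "xs \<noteq> []"
  shows "subseq (word_power (x # rev xs) d) (word_power (x # xs) (length xs * d))"
proof -
  obtain ys z where xs: "xs = ys @ [z]" using assms by (cases xs rule: rev_cases) auto
  have "subseq ([x, z] @ rev ys) ((x # xs) @ word_power (x # xs) (length (rev ys)))"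
    by (intro list_emb_append_mono subseq_word_power_length) (auto simp: xs subseq_singleton_left)
  then have "subseq (x # rev xs) (word_power (x # xs) (length xs))" by (simp add: xs)
  then show ?thesis
    using subseq_word_power_mono word_power_mult by metis
qed

lemma word_power_rotate: "x # word_power (xs @ [x]) d = word_power (x # xs) d @ [x]"
  by (induction d) auto

text \<open>\<open>rev (x # xs)\<close> is a rotation of \<open>x # rev xs\<close>. Appending a
  final x and dropping the leading one pays for the rotation with a single copy, whatever d
  is.\<close>

lemma subseq_power_rev:
  assumes "xs \<noteq> []"
  shows "subseq (word_power (rev (x # xs)) d) (word_power (x # xs) (length xs * d + 1))"
proof -
  have "subseq (word_power (x # rev xs) d @ [x]) (word_power (x # xs) (length xs * d) @ (x # xs))"
    using assms by (intro list_emb_append_mono subseq_power_rotated_rev) auto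
  then have "subseq (x # word_power (rev xs @ [x]) d) (word_power (x # xs) (length xs * d + 1))"
    by (simp only: word_power_rotate word_power_add) simp
  then show ?thesis unfolding rev.simps by (rule subseq_Cons')
qed

lemma subseq_power_rotated: "subseq (word_power (xs @ [x]) d) (word_power (x # xs) (d + 1))"
proof -
  have "subseq (word_power (x # xs) d @ [x]) (word_power (x # xs) d @ (x # xs))"
    by (intro list_emb_append_mono) auto
  then have "subseq (x # word_power (xs @ [x]) d) (word_power (x # xs) (d + 1))"
    by (simp only: word_power_rotate word_power_add) simp
  then show ?thesis by (rule subseq_Cons')
qed

text \<open>The run type with the larger total is made the cheap one: p is b if B \<le> A, and
  otherwise \<open>x # rev xs\<close>, whose reversal is a rotation of b.\<close>

lemma alternating_embeds:
  assumes "distinct b" "length b \<ge> 2"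
    and A: "A = (\<Sum>i | 1 \<le> i \<and> i \<le> n \<and> odd i. e i)"
    and B: "B = (\<Sum>i | 1 \<le> i \<and> i \<le> n \<and> even i. e i)"
  obtains p where "distinct p" "length p = length b"
    "subseq (alternating p n e) (word_power b ((length b - 1) * min A B + max A B + n div 2))"
proof -
  obtain x xs where b: "b = x # xs" "xs \<noteq> []" using assms(2) by (cases b; cases "tl b") auto
  show ?thesis
  proof (cases "B \<le> A")
    case True
    have "subseq (alternating b n e) (word_power b (1 * A + length xs * B + n div 2))"
      unfolding A B by (rule subseq_alternating_word_power) (use subseq_power_rev b in auto)
    with True b assms(1) show ?thesis by (intro that[of b]) (auto simp: ac_simps)
  next
    case False
    \<comment> \<open>Using \<open>rev b\<close> here would charge the extra copy to the I-runs, one too many when \<open>n\<close> is odd.\<close>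
    have "subseq (alternating (x # rev xs) n e) (word_power b (length xs * A + 1 * B + n div 2))"
      unfolding A B
      by (rule subseq_alternating_word_power)
        (use subseq_power_rotated_rev subseq_power_rotated[of xs x] b in auto)
    with False b assms(1) show ?thesis by (intro that[of "x # rev xs"]) auto
  qed
qed

lemma distinct_renaming:
  assumes "distinct p" "distinct q" "length p = length q"
  obtains g where "inj_on g (set p)" "map g p = q"
proof
  let ?g = "\<lambda>x. the (map_of (zip p q) x)"
  show map: "map ?g p = q"
    using assms by (intro nth_equalityI) (auto simp: map_of_zip_nth)
  then show "inj_on ?g (set p)" using assms(2) distinct_map by metis
qed

lemma contains_alternatingI:
  assumes "distinct p" "distinct q" "length p = length q" "subseq (alternating p n e) f"
  shows "contains f (alternating q n e)"
proof -
  obtain g where "inj_on g (set p)" "map g p = q"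
    using distinct_renaming assms by metis
  then show ?thesis
    using assms(4) set_alternating_subset unfolding contains_def
    by (metis inj_on_subset map_alternating)
qed

section \<open>Counting non-ascents\<close>

fun nonascents :: "'a :: linorder list \<Rightarrow> nat" where
  "nonascents (x # y # zs) = of_bool (y \<le> x) + nonascents (y # zs)"
| "nonascents _ = 0"

text \<open>The extra term is the wrap-around pair, which appears wherever two copies of w meet in a
  power.\<close>

definition cyclic_nonascents :: "'a :: linorder list \<Rightarrow> nat" where
  "cyclic_nonascents w = nonascents w + of_bool (hd w \<le> last w)"

lemma nonascents_append:
  "xs \<noteq> [] \<Longrightarrow> ys \<noteq> [] \<Longrightarrow>
     nonascents (xs @ ys) = nonascents xs + of_bool (hd ys \<le> last xs) + nonascents ys"
proof (induction xs rule: nonascents.induct)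
  case ("2_2" x)
  then show ?case by (cases ys) auto
qed auto

lemma nonascents_append_le: "nonascents (xs @ ys) \<le> nonascents xs + nonascents ys + 1"
  by (cases "xs = [] \<or> ys = []") (auto simp: nonascents_append)

lemma nonascents_strict_sorted: "sorted_wrt (<) w \<Longrightarrow> nonascents w = 0"
  by (induction w rule: nonascents.induct) auto

lemma nonascents_eq_0D: "nonascents w = 0 \<Longrightarrow> w \<noteq> [] \<Longrightarrow> hd w \<le> last w"
  by (induction w rule: nonascents.induct) (auto split: if_splits)

lemma cyclic_nonascents_pos: "w \<noteq> [] \<Longrightarrow> cyclic_nonascents w \<ge> 1"
  using nonascents_eq_0D[of w] by (cases "nonascents w = 0") (auto simp: cyclic_nonascents_def)

lemma nonascents_rev:
  "distinct w \<Longrightarrow> w \<noteq> [] \<Longrightarrow> nonascents (rev w) + nonascents w + 1 = length w"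
proof (induction w rule: nonascents.induct)
  case (1 x y zs)
  have "nonascents (rev (y # zs) @ [x]) = nonascents (rev (y # zs)) + of_bool (x \<le> y)"
    by (subst nonascents_append) auto
  with 1 show ?case by auto
qed auto

text \<open>On a circle w has \<open>length w\<close> neighbouring pairs, and reversal swaps ascents
  with non-ascents. Length at least 2 makes the wrap-around pair consist of different
  letters.\<close>

lemma cyclic_nonascents_rev:
  assumes "distinct w" "length w \<ge> 2"
  shows "cyclic_nonascents (rev w) + cyclic_nonascents w = length w"
proof -
  obtain x y ys where "w = x # ys @ [y]"
    using assms(2) by (cases w; cases "tl w" rule: rev_cases) auto
  then have "hd w \<noteq> last w" using assms(1) by auto
  moreover have "w \<noteq> []" using assms by auto
  ultimately show ?thesis
    using nonascents_rev[OF assms(1)] by (auto simp: cyclic_nonascents_def hd_rev last_rev)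
qed

text \<open>The d copies have d - 1 seams; adding the missing wrap-around completes d full
  cycles.\<close>

lemma nonascents_word_power:
  assumes "w \<noteq> []" "d \<ge> 1"
  shows "nonascents (word_power w d) + of_bool (hd w \<le> last w) = d * cyclic_nonascents w"
  using assms(2)
proof (induction d rule: nat_induct_at_least)
  case (Suc d)
  then show ?case
    using assms(1)
    by (simp add: nonascents_append word_power_eq_Nil_iff hd_word_power cyclic_nonascents_def)
qed (simp add: cyclic_nonascents_def)

text \<open>Each copy of w holds an increasing piece of t, so non-ascents arise only at the at most
  s - 1 seams between pieces. Nonemptiness of t excludes s = 0.\<close>

lemma nonascents_subseq_power:
  assumes "sorted_wrt (<) w" "subseq t (word_power w s)" "t \<noteq> []"
  shows "nonascents t + 1 \<le> s"
  using assms(2,3)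
proof (induction s arbitrary: t)
  case (Suc s)
  then obtain t1 t2 where t: "t = t1 @ t2" "subseq t1 w" "subseq t2 (word_power w s)"
    by (auto simp: subseq_append_iff)
  have "sorted_wrt (<) t1"
    using t(2) assms(1) by (auto simp: subseq_conv_nths strict_sorted_iff sorted_nths)
  then have t1: "nonascents t1 = 0" by (rule nonascents_strict_sorted)
  show ?case
  proof (cases "t2 = []")
    case False
    then have "nonascents t2 + 1 \<le> s" using Suc.IH t(3) by blast
    then show ?thesis using nonascents_append_le[of t1 t2] t t1 by simp
  qed (use t t1 in auto)
qed simp

text \<open>Consecutive runs meet in equal letters, so each of the n - 1 seams is a non-ascent.
  Against full cycles, a run lacks only its final wrap-around.\<close>

lemma nonascents_alternating:
  assumes "distinct p" "length p \<ge> 2" "n \<ge> 1" "\<And>i. 1 \<le> i \<Longrightarrow> i \<le> n \<Longrightarrow> e i \<ge> 1"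
  shows "nonascents (alternating p n e) + 1 \<ge>
     cyclic_nonascents p * (\<Sum>i | 1 \<le> i \<and> i \<le> n \<and> odd i. e i) +
     cyclic_nonascents (rev p) * (\<Sum>i | 1 \<le> i \<and> i \<le> n \<and> even i. e i) + n div 2"
    (is "_ \<ge> ?k * ?A n + ?k' * ?B n + _")
proof -
  obtain x y ys where "p = x # ys @ [y]"
    using assms(2) by (cases p; cases "tl p" rule: rev_cases) auto
  then have neq: "hd p \<noteq> last p" and ne: "p \<noteq> []" using assms(1) by auto
  define \<delta> where "\<delta> = (of_bool (hd p \<le> last p) :: nat)"
  have \<delta>: "of_bool (hd (rev p) \<le> last (rev p)) = 1 - \<delta>"
    using neq by (auto simp: \<delta>_def hd_rev last_rev)
  \<comment> \<open>Exact count: the n - n div 2 runs of p lose \<open>\<delta>\<close> each, the n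
    div 2 runs of \<open>rev p\<close> lose 1 - \<open>\<delta>\<close> each. The last letter is
    carried along for the next seam.\<close>
  have "alternating p n e \<noteq> [] \<and> last (alternating p n e) = (if odd n then last p else hd p) \<and>
     nonascents (alternating p n e) + 1 + (n - n div 2) * \<delta> + (n div 2) * (1 - \<delta>) =
     n + ?k * ?A n + ?k' * ?B n"
    using assms(3,4)
  proof (induction n rule: nat_induct_at_least)
    case base
    have "{i :: nat. 1 \<le> i \<and> i \<le> 1 \<and> even i} = {}" "{i :: nat. 1 \<le> i \<and> i \<le> 1 \<and> odd i} = {1}"
      by auto
    then have sums: "?A 1 = e 1" "?B 1 = 0" by (simp_all only: sum.insert sum.empty finite.emptyI) simp_all
    have e1: "e 1 \<ge> 1" using base by simp
    have alt: "alternating p 1 e = word_power p (e 1)"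
      using alternating_Suc[of p 0 e] by simp
    have "nonascents (word_power p (e 1)) + \<delta> = e 1 * ?k"
      using nonascents_word_power[OF ne e1] by (simp only: \<delta>_def)
    moreover have "word_power p (e 1) \<noteq> [] \<and> last (word_power p (e 1)) = last p"
      using ne e1 by (simp add: word_power_eq_Nil_iff last_word_power)
    ultimately show ?case unfolding alt sums by (simp add: mult.commute)
  next
    case (Suc n)
    define w where "w = (if odd (Suc n) then p else rev p)"
    have w: "w \<noteq> []" using ne by (simp add: w_def)
    have e: "e (Suc n) \<ge> 1" using Suc.prems by simp
    have IH: "alternating p n e \<noteq> []" "last (alternating p n e) = (if odd n then last p else hd p)"
      "nonascents (alternating p n e) + 1 + (n - n div 2) * \<delta> + (n div 2) * (1 - \<delta>) =
        n + ?k * ?A n + ?k' * ?B n"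
      using Suc.IH Suc.prems le_SucI by presburger+
    have hd: "hd w = last (alternating p n e)"
      using IH(2) ne by (auto simp: w_def hd_rev)
    have *: "nonascents (alternating p (Suc n) e) =
        nonascents (alternating p n e) + 1 + nonascents (word_power w (e (Suc n)))"
      using IH(1) w e hd unfolding alternating_Suc w_def[symmetric]
      by (subst nonascents_append) (auto simp: word_power_eq_Nil_iff hd_word_power)
    have **: "nonascents (word_power w (e (Suc n))) + (if odd (Suc n) then \<delta> else 1 - \<delta>) =
        e (Suc n) * cyclic_nonascents w"
      using nonascents_word_power[OF w e] \<delta> by (auto simp: w_def \<delta>_def)
    have "\<delta> = 0 \<or> \<delta> = 1" by (auto simp: \<delta>_def)
    then have "nonascents (alternating p (Suc n) e) + 1 + (Suc n - Suc n div 2) * \<delta> +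
        (Suc n div 2) * (1 - \<delta>) = Suc n + ?k * ?A (Suc n) + ?k' * ?B (Suc n)"
      using IH(3) ** unfolding * sum_upto_filter_Suc
      by (cases "odd n") (auto simp: w_def algebra_simps)
    moreover have "last (alternating p (Suc n) e) = (if odd (Suc n) then last p else hd p)"
      using e w ne unfolding alternating_Suc w_def[symmetric]
      by (auto simp: word_power_eq_Nil_iff last_word_power) (auto simp: w_def last_rev)
    ultimately show ?case using IH(1) by (auto simp: alternating_Suc)
  qed
  \<comment> \<open>The surplus over the cycles is n div 2 for \<open>\<delta>\<close> = 1 and n - n
    div 2, which is no smaller, for \<open>\<delta>\<close> = 0.\<close>
  moreover have "\<delta> = 0 \<or> \<delta> = 1" by (auto simp: \<delta>_def)
  ultimately show ?thesis by auto
qed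

text \<open>A + B equals maximum plus minimum; the remaining weights k - 1 and k' - 1 add up to c -
  2 and multiply numbers that are at least the minimum.\<close>

lemma mixed_sum_ge:
  fixes A B k k' c :: nat
  assumes "k \<ge> 1" "k' \<ge> 1" "k' + k = c"
  shows "(c - 1) * min A B + max A B \<le> k * A + k' * B"
proof -
  obtain i j where "k = Suc i" "k' = Suc j" using assms by (metis Suc_le_D One_nat_def)
  moreover have "i * min A B \<le> i * A" "j * min A B \<le> j * B" by auto
  ultimately show ?thesis using assms by (auto simp: algebra_simps min_def max_def split: if_splits)
qed

text \<open>Inverting the renaming shows that t itself alternates over a distinct word p, so its
  non-ascents can be counted in the order of the host, in which w increases.\<close>

lemma power_contains_alternating_length:
  fixes w :: "'a :: linorder list"
  assumes "contains (word_power w s) (alternating q n e)" "sorted_wrt (<) w"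
    and "distinct q" "length q \<ge> 2" "n \<ge> 1" "\<And>i. 1 \<le> i \<Longrightarrow> i \<le> n \<Longrightarrow> e i \<ge> 1"
    and A: "A = (\<Sum>i | 1 \<le> i \<and> i \<le> n \<and> odd i. e i)"
    and B: "B = (\<Sum>i | 1 \<le> i \<and> i \<le> n \<and> even i. e i)"
  shows "(length q - 1) * min A B + max A B + n div 2 \<le> s"
proof -
  obtain t g where t: "subseq t (word_power w s)" "inj_on g (set t)" "map g t = alternating q n e"
    using assms(1) unfolding contains_def by blast
  define h where "h = inv_into (set t) g"
  define p where "p = map h q"
  have "t = map h (map g t)" using t(2) by (simp add: h_def map_idI)
  then have tp: "t = alternating p n e" by (simp add: t(3) map_alternating p_def)
  \<comment> \<open>Since the first run is nonempty, every letter of q occurs, and the inverse of g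
    is injective on q.\<close>
  have q: "set q \<subseteq> g ` set t"
    using set_alternating_superset[of n e q] assms(5,6) t(3) by (metis le_refl set_map)
  then have "distinct p"
    using assms(3) by (auto simp: p_def distinct_map h_def intro: inj_on_inv_into)
  have len: "length p = length q" by (simp add: p_def)
  have "t \<noteq> []" using q assms(4) by auto
  then have "nonascents t + 1 \<le> s" using nonascents_subseq_power assms(2) t(1) by blast
  moreover have "cyclic_nonascents p * A + cyclic_nonascents (rev p) * B + n div 2 \<le> nonascents t + 1"
    unfolding tp A B
    by (rule nonascents_alternating) (use \<open>distinct p\<close> len assms(4-6) in auto)
  moreover have "p \<noteq> []" using len assms(4) by auto
  then have "(length p - 1) * min A B + max A B \<le> cyclic_nonascents p * A + cyclic_nonascents (rev p) * B"
    using cyclic_nonascents_rev[OF \<open>distinct p\<close>] len assms(4)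
    by (intro mixed_sum_ge cyclic_nonascents_pos) auto
  ultimately show ?thesis using len by simp
qed

section \<open>Assembly of the two bounds\<close>

lemma formation_word_power: "formation r s (word_power [0..<r] s)"
  unfolding formation_def word_power_def
  by (intro exI[of _ "{0..<r}"] exI[of _ "replicate s [0..<r]"]) auto

theorem theorem1p5:
  fixes c n :: nat and e :: "nat \<Rightarrow> nat" and u :: "nat list" and A B M m :: nat
  assumes "c \<ge> 2" and "n \<ge> 1"
    and "\<And>i. 1 \<le> i \<Longrightarrow> i \<le> n \<Longrightarrow> e i \<ge> 1"
    and "u = alternating_word c n e"
    and "A = (\<Sum>i | 1 \<le> i \<and> i \<le> n \<and> odd i. e i)"
    and "B = (\<Sum>i | 1 \<le> i \<and> i \<le> n \<and> even i. e i)"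
    and "M = max A B" and "m = min A B"
  shows "(c - 1) * m + M + n div 2 \<le> fw u \<and>
         fw u \<le> 2 * (c - 1) * m + 2 * M + 2 * (n div 2) - 1"
proof -
  define L where "L = (c - 1) * m + M + n div 2"
  have u: "u = alternating (inc_word c) n e" using assms(4) alternating_word_eq by simp
  have inc: "distinct (inc_word c)" "length (inc_word c) = c" by (auto simp: inc_word_def)
  define Q where "Q s \<longleftrightarrow> (\<exists>r. \<forall>f :: nat list. formation r s f \<longrightarrow> contains f u)" for s
  obtain r where r: "\<And>f :: nat list. formation r (2 * L - 1) f \<Longrightarrow>
      \<exists>b. distinct b \<and> length b = c \<and> subseq (word_power b L) f"
    using formation_contains_word_power[of L c] by blast
  have "contains f u" if "formation r (2 * L - 1) f" for f :: "nat list"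
  proof -
    obtain b where b: "distinct b" "length b = c" "subseq (word_power b L) f"
      using r \<open>formation r (2 * L - 1) f\<close> by blast
    obtain p where p: "distinct p" "length p = length b"
      "subseq (alternating p n e) (word_power b L)"
      using alternating_embeds[where b = b and e = e and n = n] b assms(1,5-8) unfolding L_def by metis
    then have "subseq (alternating p n e) f" using b(3) subseq_order.trans by blast
    then show ?thesis
      unfolding u using contains_alternatingI p b inc by metis
  qed
  then have Q: "Q (2 * L - 1)" unfolding Q_def by blast
  have fw: "fw u = (LEAST s. Q s)" by (simp add: fw_def Q_def)
  \<comment> \<open>The witness 2L - 1 makes the minimum attained. Whatever r' belongs to it,
    repeating the increasing word \<open>[0..<r']\<close> is a formation to which the count
    applies.\<close>
  have "Q (fw u)" unfolding fw using Q by (rule LeastI)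
  then obtain r' where "contains (word_power [0..<r'] (fw u)) u"
    unfolding Q_def using formation_word_power by blast
  then have "(length (inc_word c) - 1) * min A B + max A B + n div 2 \<le> fw u"
    unfolding u by (rule power_contains_alternating_length) (use inc assms in auto)
  then have "L \<le> fw u" using inc assms(7,8) by (simp add: L_def)
  moreover have "fw u \<le> 2 * L - 1" unfolding fw using Q by (rule Least_le)
  ultimately show ?thesis by (simp add: L_def algebra_simps)
qed

end
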